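(* Let $a=[a'_1,a'_2,a'_3]$, $b=[b'_1,b'_2,b'_3]$, $c=[c'_1,c'_2,c'_3]\in\mathbb{T}\mathbb{P}^2$ be three different interior points. Then $a,b,c$ determine a transversal tropical triangle if and only if, perhaps after relabeling the three points, the following six inequalities hold: $$b'_1-b'_2<a'_1-a'_2<c'_1-c'_2,\qquad a'_2-a'_3<c'_2-c'_3<b'_2-b'_3,\qquad c'_3-c'_1<b'_3-b'_1<a'_3-a'_1.$$
   Context: The tropical semifield is $\mathbb{T}=\mathbb{R}\cup\{-\infty\}$ with $x\oplus y=\max\{x,y\}$, $x\odot y=x+y$. $\mathbb{T}\mathbb{P}^2$ is $\mathbb{T}^3\setminus\{(-\infty,-\infty,-\infty)\}$ modulo adding real multiples of $(1,1,1)$; classes are written $[x_1,x_2,x_3]$; a point is interior if all coordinates are real. A tropical line is a set $\{[x_1,x_2,x_3]:\max\{u_1+x_1,u_2+x_2,u_3+x_3\}\text{ attained at least twice}\}$ with $u_1,u_2,u_3\in\mathbb{R}$. Two points are transversal if exactly one tropical line passes through both; for transversal points $p,q$ this line is denoted $pq$. Two tropical lines are transversal if they intersect in exactly one point. Three points $a,b,c$ determine a transversal tropical triangle if they are distinct, tropically non-collinear (no tropical line contains all three), pairwise transversal, and the three tropical lines $ab,bc,ca$ are pairwise transversal. *)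

theory Defs
  imports "HOL-Analysis.Analysis" "HOL-Library.Multiset"
begin

(* The tropical semifield consists of the elements of ereal other than \<infinity>; tropical addition
   is max and tropical multiplication is +. *)

definition tp_coords :: "(ereal \<times> ereal \<times> ereal) set" where
  "tp_coords = {(x1, x2, x3). x1 \<noteq> \<infinity> \<and> x2 \<noteq> \<infinity> \<and> x3 \<noteq> \<infinity> \<and>
                  (x1, x2, x3) \<noteq> (-\<infinity>, -\<infinity>, -\<infinity>)}"

definition tp_shift :: "real \<Rightarrow> ereal \<times> ereal \<times> ereal \<Rightarrow> ereal \<times> ereal \<times> ereal" where
  "tp_shift t = (\<lambda>(x1, x2, x3). (ereal t + x1, ereal t + x2, ereal t + x3))"

definition tp_rel :: "ereal \<times> ereal \<times> ereal \<Rightarrow> ereal \<times> ereal \<times> ereal \<Rightarrow> bool" where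
  "tp_rel x y \<longleftrightarrow> x \<in> tp_coords \<and> y \<in> tp_coords \<and> (\<exists>t. y = tp_shift t x)"

lemma tp_shift_0 [simp]: "tp_shift 0 x = x"
  by (cases x) (simp add: tp_shift_def flip: zero_ereal_def)

lemma tp_shift_shift [simp]: "tp_shift s (tp_shift t x) = tp_shift (s + t) x"
  by (cases x) (simp add: tp_shift_def add.assoc flip: plus_ereal.simps(1))

lemma tp_rel_refl_iff [simp]: "tp_rel x x \<longleftrightarrow> x \<in> tp_coords"
  unfolding tp_rel_def by (metis tp_shift_0)

lemma tp_rel_sym: "tp_rel x y \<Longrightarrow> tp_rel y x"
  unfolding tp_rel_def by (metis add.left_inverse tp_shift_0 tp_shift_shift)

lemma tp_rel_trans: "tp_rel x y \<Longrightarrow> tp_rel y z \<Longrightarrow> tp_rel x z"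
  unfolding tp_rel_def by (metis tp_shift_shift)

lemma zero_in_tp_coords: "(0, 0, 0) \<in> tp_coords"
  by (simp add: tp_coords_def)

quotient_type tp2 = "ereal \<times> ereal \<times> ereal" / partial: tp_rel
proof (rule part_equivpI)
  show "\<exists>x. tp_rel x x"
    using zero_in_tp_coords by auto
  show "symp tp_rel"
    by (rule sympI) (rule tp_rel_sym)
  show "transp tp_rel"
    by (rule transpI) (rule tp_rel_trans)
qed

(* The class [x1, x2, x3]; meaningful only for (x1, x2, x3) in tp_coords. *)
definition tp_class :: "ereal \<Rightarrow> ereal \<Rightarrow> ereal \<Rightarrow> tp2" where
  "tp_class x1 x2 x3 = abs_tp2 (x1, x2, x3)"

lemma tp_class_eq_iff:
  assumes "(x1, x2, x3) \<in> tp_coords" "(y1, y2, y3) \<in> tp_coords"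
  shows "tp_class x1 x2 x3 = tp_class y1 y2 y3 \<longleftrightarrow>
    (\<exists>t::real. y1 = ereal t + x1 \<and> y2 = ereal t + x2 \<and> y3 = ereal t + x3)"
proof -
  have "tp_class x1 x2 x3 = tp_class y1 y2 y3 \<longleftrightarrow> tp_rel (x1, x2, x3) (y1, y2, y3)"
    unfolding tp_class_def using Quotient3_rel[OF Quotient3_tp2] assms by fastforce
  then show ?thesis
    using assms by (simp add: tp_rel_def tp_shift_def)
qed

definition max_attained_twice :: "ereal \<Rightarrow> ereal \<Rightarrow> ereal \<Rightarrow> bool" where
  "max_attained_twice s1 s2 s3 \<longleftrightarrow>
     (let m = max s1 (max s2 s3) in s1 = m \<and> s2 = m \<or> s2 = m \<and> s3 = m \<or> s1 = m \<and> s3 = m)"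

definition trop_line :: "real \<Rightarrow> real \<Rightarrow> real \<Rightarrow> tp2 set" where
  "trop_line u1 u2 u3 =
     {tp_class x1 x2 x3 | x1 x2 x3. (x1, x2, x3) \<in> tp_coords \<and>
        max_attained_twice (ereal u1 + x1) (ereal u2 + x2) (ereal u3 + x3)}"

definition trop_lines :: "tp2 set set" where
  "trop_lines = {trop_line u1 u2 u3 | u1 u2 u3. True}"

definition transversal_points :: "tp2 \<Rightarrow> tp2 \<Rightarrow> bool" where
  "transversal_points p q \<longleftrightarrow> (\<exists>!L. L \<in> trop_lines \<and> p \<in> L \<and> q \<in> L)"

definition line_through :: "tp2 \<Rightarrow> tp2 \<Rightarrow> tp2 set" where
  "line_through p q = (THE L. L \<in> trop_lines \<and> p \<in> L \<and> q \<in> L)"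

definition transversal_lines :: "tp2 set \<Rightarrow> tp2 set \<Rightarrow> bool" where
  "transversal_lines L M \<longleftrightarrow> (\<exists>!p. p \<in> L \<inter> M)"

definition trop_collinear :: "tp2 \<Rightarrow> tp2 \<Rightarrow> tp2 \<Rightarrow> bool" where
  "trop_collinear p q r \<longleftrightarrow> (\<exists>L\<in>trop_lines. p \<in> L \<and> q \<in> L \<and> r \<in> L)"

definition transversal_triangle :: "tp2 \<Rightarrow> tp2 \<Rightarrow> tp2 \<Rightarrow> bool" where
  "transversal_triangle a b c \<longleftrightarrow>
     distinct [a, b, c] \<and>
     \<not> trop_collinear a b c \<and>
     transversal_points a b \<and> transversal_points b c \<and> transversal_points c a \<and>
     transversal_lines (line_through a b) (line_through b c) \<and>
     transversal_lines (line_through b c) (line_through c a) \<and>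
     transversal_lines (line_through c a) (line_through a b)"

end

theory Submission
  imports Defs
begin

text \<open>Cramer's rule holds tropically: for interior points \<open>p\<close>, \<open>q\<close> the line with coefficient
vector the tropical cross product of \<open>p\<close> and \<open>q\<close> passes through both, and it is the only such line
iff no tropical \<open>2 \<times> 2\<close> minor has its maximum attained twice. Dually, the same condition on the
coefficient vectors says when two lines meet in one point. This reduces the theorem to linear
inequalities in the differences of the coordinates, settled after sorting the points by
\<open>x\<^sub>1 - x\<^sub>3\<close>. Non-collinearity is a consequence of the other conditions, as collinear
points would have \<open>ab = bc\<close>.\<close>

section \<open>Incidence and genericity of real coefficient vectors\<close>

type_synonym vec3 = "real \<times> real \<times> real"

definition pt :: "vec3 \<Rightarrow> tp2" where
  "pt = (\<lambda>(x1, x2, x3). tp_class (ereal x1) (ereal x2) (ereal x3))"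

definition ln_of :: "vec3 \<Rightarrow> tp2 set" where
  "ln_of = (\<lambda>(u1, u2, u3). trop_line u1 u2 u3)"

text \<open>Tropical proportionality: equality of interior points, or of lines, in terms of
  representatives.\<close>

definition prop_vec :: "vec3 \<Rightarrow> vec3 \<Rightarrow> bool" where
  "prop_vec = (\<lambda>(p1, p2, p3) (q1, q2, q3). q1 - p1 = q2 - p2 \<and> q2 - p2 = q3 - p3)"

definition incident :: "vec3 \<Rightarrow> vec3 \<Rightarrow> bool" where
  "incident = (\<lambda>(u1, u2, u3) (x1, x2, x3).
     u1 + x1 = u2 + x2 \<and> u3 + x3 \<le> u1 + x1 \<or>
     u2 + x2 = u3 + x3 \<and> u1 + x1 \<le> u2 + x2 \<or>
     u1 + x1 = u3 + x3 \<and> u2 + x2 \<le> u1 + x1)"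

text \<open>Each disequation says that a tropical minor does not tie, as in
  \<open>p1 + q2 \<noteq> p2 + q1\<close>, rearranged to the coordinate differences of the
  theorem.\<close>

definition generic :: "vec3 \<Rightarrow> vec3 \<Rightarrow> bool" where
  "generic = (\<lambda>(p1, p2, p3) (q1, q2, q3).
     p1 - p2 \<noteq> q1 - q2 \<and> p2 - p3 \<noteq> q2 - q3 \<and> p3 - p1 \<noteq> q3 - q1)"

definition trop_cross :: "vec3 \<Rightarrow> vec3 \<Rightarrow> vec3" where
  "trop_cross = (\<lambda>(p1, p2, p3) (q1, q2, q3).
     (max (p2 + q3) (p3 + q2), max (p3 + q1) (p1 + q3), max (p1 + q2) (p2 + q1)))"

lemma generic_sym: "generic p q \<longleftrightarrow> generic q p"
  by (cases p; cases q) (auto simp: generic_def)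

lemma not_generic_self [simp]: "\<not> generic p p"
  by (cases p) (simp add: generic_def)

lemma trop_cross_commute: "trop_cross p q = trop_cross q p"
  by (cases p; cases q) (simp add: trop_cross_def max.commute add.commute)

lemma incident_sym: "incident u x \<longleftrightarrow> incident x u"
  by (cases u; cases x) (simp add: incident_def add.commute)

text \<open>A tropical determinant with a repeated row: each sum such as \<open>p1 + p2 + q3\<close>
  occurs in two of the three terms, so the maximum is attained twice.\<close>

lemma incident_trop_cross:
  "incident (trop_cross p q) p" "incident (trop_cross p q) q"
  by (cases p; cases q; auto simp: incident_def trop_cross_def max_def)+

text \<open>Ties in the same two coordinates at \<open>p\<close> and \<open>q\<close> would violate
  genericity. Ties in different pairs fix \<open>u\<close> up to a shift, and the inequalities of
  incidence select the matching entries in the maxima of \<open>trop_cross\<close>.\<close>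

lemma incident_generic_unique:
  assumes "generic p q" "incident u p" "incident u q"
  shows "prop_vec (trop_cross p q) u"
  using assms
  by (cases p; cases q; cases u)
    (simp add: incident_def generic_def prop_vec_def trop_cross_def max_def; argo)

text \<open>Where a minor ties, coefficients opposite to \<open>p\<close> give a tie at both points;
  every small enough third coefficient keeps it maximal.\<close>

lemma not_generic_two_incident:
  assumes "\<not> generic p q"
  obtains u v where "incident u p" "incident u q" "incident v p" "incident v q" "\<not> prop_vec u v"
proof -
  obtain p1 p2 p3 q1 q2 q3 where pq: "p = (p1, p2, p3)" "q = (q1, q2, q3)"
    by (cases p; cases q)
  consider "p1 - p2 = q1 - q2" | "p2 - p3 = q2 - q3" | "p3 - p1 = q3 - q1"
    using assms by (auto simp: pq generic_def)
  then show thesis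
  proof cases
    case 1
    \<comment> \<open>The ties have height 0 at \<open>p\<close> and \<open>q1 - p1\<close> at
      \<open>q\<close>; \<open>?s\<close> is the largest coefficient whose term exceeds neither. The
      other cases permute the coordinates.\<close>
    let ?s = "min (- p3) (q1 - p1 - q3)"
    show ?thesis
      by (rule that[of "(- p1, - p2, ?s)" "(- p1, - p2, ?s - 1)"])
        (use 1 in \<open>auto simp: pq incident_def prop_vec_def\<close>)
  next
    case 2
    let ?s = "min (- p1) (q2 - p2 - q1)"
    show ?thesis
      by (rule that[of "(?s, - p2, - p3)" "(?s - 1, - p2, - p3)"])
        (use 2 in \<open>auto simp: pq incident_def prop_vec_def\<close>)
  next
    case 3
    let ?s = "min (- p2) (q1 - p1 - q2)"
    show ?thesis
      by (rule that[of "(- p1, ?s, - p3)" "(- p1, ?s - 1, - p3)"])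
        (use 3 in \<open>auto simp: pq incident_def prop_vec_def\<close>)
  qed
qed

section \<open>Passage to points and lines of the projective plane\<close>

lemma pt_eq_iff: "pt p = pt q \<longleftrightarrow> prop_vec p q"
proof (cases p; cases q)
  fix p1 p2 p3 q1 q2 q3
  assume pq: "p = (p1, p2, p3)" "q = (q1, q2, q3)"
  have "pt p = pt q \<longleftrightarrow> (\<exists>t. q1 = t + p1 \<and> q2 = t + p2 \<and> q3 = t + p3)"
    by (simp add: pq pt_def tp_class_eq_iff tp_coords_def)
  also have "\<dots> \<longleftrightarrow> prop_vec p q"
    by (auto simp: pq prop_vec_def intro!: exI[of _ "q1 - p1"])
  finally show ?thesis .
qed

lemma max_attained_twice_shift:
  "max_attained_twice (ereal t + a) (ereal t + b) (ereal t + c) \<longleftrightarrow> max_attained_twice a b c"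
  by (cases a; cases b; cases c)
    (auto simp: max_attained_twice_def Let_def max_def)

text \<open>\<open>trop_line\<close> asks for some representative of the class; any two differ by a
  shift, which preserves ties.\<close>

lemma class_mem_trop_line_iff:
  assumes "(x1, x2, x3) \<in> tp_coords"
  shows "tp_class x1 x2 x3 \<in> trop_line u1 u2 u3 \<longleftrightarrow>
    max_attained_twice (ereal u1 + x1) (ereal u2 + x2) (ereal u3 + x3)"
proof
  assume "tp_class x1 x2 x3 \<in> trop_line u1 u2 u3"
  then obtain y1 y2 y3 where y: "(y1, y2, y3) \<in> tp_coords"
    "tp_class x1 x2 x3 = tp_class y1 y2 y3"
    "max_attained_twice (ereal u1 + y1) (ereal u2 + y2) (ereal u3 + y3)"
    by (auto simp: trop_line_def)
  then obtain t where "y1 = ereal t + x1" "y2 = ereal t + x2" "y3 = ereal t + x3"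
    using tp_class_eq_iff[OF assms y(1)] by auto
  with y(3) show "max_attained_twice (ereal u1 + x1) (ereal u2 + x2) (ereal u3 + x3)"
    by (simp add: add.left_commute[of _ "ereal t"] max_attained_twice_shift)
qed (use assms in \<open>auto simp: trop_line_def\<close>)

lemma pt_mem_iff: "pt x \<in> ln_of u \<longleftrightarrow> incident u x"
proof (cases x; cases u)
  fix x1 x2 x3 u1 u2 u3
  assume "x = (x1, x2, x3)" "u = (u1, u2, u3)"
  then show ?thesis
    by (simp add: pt_def ln_of_def class_mem_trop_line_iff tp_coords_def)
      (auto simp: max_attained_twice_def incident_def Let_def max_def)
qed

lemma ln_of_prop_vec:
  assumes "prop_vec u v"
  shows "ln_of u = ln_of v"
proof -
  obtain u1 u2 u3 where u: "u = (u1, u2, u3)" by (cases u)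
  obtain t where v: "v = (t + u1, t + u2, t + u3)"
    using assms by (cases v) (auto simp: u prop_vec_def intro!: that[of "fst v - u1"])
  show ?thesis
    unfolding u v ln_of_def trop_line_def
    by (simp add: add.assoc max_attained_twice_shift flip: plus_ereal.simps(1))
qed

lemma ln_of_eq_iff: "ln_of u = ln_of v \<longleftrightarrow> prop_vec u v"
proof
  assume eq: "ln_of u = ln_of v"
  obtain u1 u2 u3 v1 v2 v3 where uv: "u = (u1, u2, u3)" "v = (v1, v2, v3)"
    by (cases u; cases v)
  have "incident u x \<longleftrightarrow> incident v x" for x
    using eq by (simp flip: pt_mem_iff)
  \<comment> \<open>Negated coefficients give the apex of a line. Each apex lies on the other line,
    so both the maximum and the minimum of the three differences \<open>v - u\<close> are attained
    twice: all three are equal.\<close>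
  from this[of "(- u1, - u2, - u3)"] this[of "(- v1, - v2, - v3)"] show "prop_vec u v"
    by (simp add: uv incident_def prop_vec_def; argo)
qed (rule ln_of_prop_vec)

lemma trop_lines_eq: "trop_lines = range ln_of"
  by (auto simp: trop_lines_def ln_of_def image_def)

text \<open>As an equivalence this serves both the unique existence in
  \<open>transversal_points\<close> and the description in \<open>line_through\<close>.\<close>

lemma generic_line_iff:
  assumes "generic p q"
  shows "L \<in> trop_lines \<and> pt p \<in> L \<and> pt q \<in> L \<longleftrightarrow> L = ln_of (trop_cross p q)"
proof
  assume L: "L \<in> trop_lines \<and> pt p \<in> L \<and> pt q \<in> L"
  then obtain u where u: "L = ln_of u"
    by (auto simp: trop_lines_eq)
  with L have "prop_vec (trop_cross p q) u"
    by (intro incident_generic_unique assms) (simp_all flip: pt_mem_iff)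
  then show "L = ln_of (trop_cross p q)"
    by (simp add: u ln_of_prop_vec)
qed (simp add: trop_lines_eq pt_mem_iff incident_trop_cross)

lemma transversal_points_iff: "transversal_points (pt p) (pt q) \<longleftrightarrow> generic p q"
proof
  assume tr: "transversal_points (pt p) (pt q)"
  show "generic p q"
  proof (rule ccontr)
    assume "\<not> generic p q"
    then obtain u v where "incident u p" "incident u q" "incident v p" "incident v q"
      and "\<not> prop_vec u v"
      by (rule not_generic_two_incident)
    with tr show False
      unfolding transversal_points_def trop_lines_eq
      by (metis rangeI pt_mem_iff ln_of_eq_iff)
  qed
qed (simp add: transversal_points_def generic_line_iff)

lemma line_through_pt:
  assumes "generic p q"
  shows "line_through (pt p) (pt q) = ln_of (trop_cross p q)"
  using assms by (simp add: line_through_def generic_line_iff)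

text \<open>The maximum of a line is finite at every point, so a boundary point lies on a line through the
tie of its two finite coordinates, and two generic lines cannot share that tie.\<close>

lemma generic_lines_meet_interior:
  assumes "generic u v" "z \<in> ln_of u" "z \<in> ln_of v"
  obtains x where "z = pt x"
proof -
  obtain u1 u2 u3 v1 v2 v3 where uv: "u = (u1, u2, u3)" "v = (v1, v2, v3)"
    by (cases u; cases v)
  obtain x1 x2 x3 where z: "z = tp_class x1 x2 x3" and x: "(x1, x2, x3) \<in> tp_coords"
    using assms(2) by (auto simp: uv ln_of_def trop_line_def)
  have "max_attained_twice (ereal u1 + x1) (ereal u2 + x2) (ereal u3 + x3)"
    "max_attained_twice (ereal v1 + x1) (ereal v2 + x2) (ereal v3 + x3)"
    using assms(2,3) class_mem_trop_line_iff[OF x] by (simp_all add: z uv ln_of_def)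
  with x assms(1) have "\<exists>r1 r2 r3. x1 = ereal r1 \<and> x2 = ereal r2 \<and> x3 = ereal r3"
    by (cases x1; cases x2; cases x3)
      (auto simp: uv tp_coords_def generic_def max_attained_twice_def Let_def max_def
        split: if_splits)
  then show thesis
    using that z by (auto simp: pt_def)
qed

text \<open>Duality: \<open>incident\<close> is symmetric, so the results on lines through two
  points apply to points on two lines, once common boundary points are excluded.\<close>

lemma transversal_lines_iff: "transversal_lines (ln_of u) (ln_of v) \<longleftrightarrow> generic u v"
proof
  assume tr: "transversal_lines (ln_of u) (ln_of v)"
  show "generic u v"
  proof (rule ccontr)
    assume "\<not> generic u v"
    then obtain x y where "incident x u" "incident x v" "incident y u" "incident y v"
      and "\<not> prop_vec x y"
      by (rule not_generic_two_incident)
    with tr show False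
      unfolding transversal_lines_def
      by (metis Int_iff pt_mem_iff pt_eq_iff incident_sym)
  qed
next
  assume gen: "generic u v"
  show "transversal_lines (ln_of u) (ln_of v)"
    unfolding transversal_lines_def
  proof (rule ex1I)
    show "pt (trop_cross u v) \<in> ln_of u \<inter> ln_of v"
      using incident_trop_cross by (simp add: pt_mem_iff incident_sym)
    fix z assume z: "z \<in> ln_of u \<inter> ln_of v"
    with gen obtain x where "z = pt x"
      by (blast elim: generic_lines_meet_interior)
    with gen z show "z = pt (trop_cross u v)"
      by (metis Int_iff pt_mem_iff pt_eq_iff incident_sym incident_generic_unique)
  qed
qed

section \<open>Triangles in terms of genericity\<close>

definition generic_triangle :: "vec3 \<Rightarrow> vec3 \<Rightarrow> vec3 \<Rightarrow> bool" where
  "generic_triangle p q r \<longleftrightarrow> generic p q \<and> generic q r \<and> generic r p \<and>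
     generic (trop_cross p q) (trop_cross q r) \<and>
     generic (trop_cross q r) (trop_cross r p) \<and>
     generic (trop_cross r p) (trop_cross p q)"

lemma transversal_triangle_iff:
  "transversal_triangle (pt p) (pt q) (pt r) \<longleftrightarrow> generic_triangle p q r"
proof
  assume "transversal_triangle (pt p) (pt q) (pt r)"
  then show "generic_triangle p q r"
    unfolding transversal_triangle_def generic_triangle_def
    by (auto simp: transversal_points_iff line_through_pt transversal_lines_iff)
next
  assume gen: "generic_triangle p q r"
  \<comment> \<open>If the points were equal, \<open>transversal_points_iff\<close> would give
    \<open>generic x x\<close>.\<close>
  have neq: "pt x \<noteq> pt y" if "generic x y" for x y
    by (metis that transversal_points_iff not_generic_self)
  have "\<not> trop_collinear (pt p) (pt q) (pt r)"
  proof
    assume "trop_collinear (pt p) (pt q) (pt r)"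
    then obtain u where "incident u p" "incident u q" "incident u r"
      by (auto simp: trop_collinear_def trop_lines_eq pt_mem_iff)
    \<comment> \<open>By uniqueness the common line is both sides, but no line is transversal to
      itself.\<close>
    with gen have "ln_of (trop_cross p q) = ln_of (trop_cross q r)"
      by (metis generic_triangle_def incident_generic_unique ln_of_prop_vec)
    with gen show False
      by (metis generic_triangle_def transversal_lines_iff not_generic_self)
  qed
  with gen neq show "transversal_triangle (pt p) (pt q) (pt r)"
    unfolding transversal_triangle_def generic_triangle_def
    by (metis distinct_length_2_or_more distinct_singleton line_through_pt transversal_lines_iff
        transversal_points_iff)
qed

text \<open>A rotation and a transposition generate all relabelings.\<close>

lemma generic_triangle_rotate: "generic_triangle p q r \<Longrightarrow> generic_triangle q r p"
  by (simp add: generic_triangle_def)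

lemma generic_triangle_swap: "generic_triangle p q r \<Longrightarrow> generic_triangle q p r"
  unfolding generic_triangle_def by (metis generic_sym trop_cross_commute)

section \<open>The six inequalities and the relabeling\<close>

definition six_ineqs :: "vec3 \<Rightarrow> vec3 \<Rightarrow> vec3 \<Rightarrow> bool" where
  "six_ineqs = (\<lambda>(a1, a2, a3) (b1, b2, b3) (c1, c2, c3).
     b1 - b2 < a1 - a2 \<and> a1 - a2 < c1 - c2 \<and>
     a2 - a3 < c2 - c3 \<and> c2 - c3 < b2 - b3 \<and>
     c3 - c1 < b3 - b1 \<and> b3 - b1 < a3 - a1)"

text \<open>The inequalities decide every maximum in the cross products; each disequation between
  lines then cancels to one between two of the points.\<close>

lemma six_ineqs_imp_generic_triangle:
  assumes "six_ineqs a b c"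
  shows "generic_triangle a b c"
  using assms
  by (cases a; cases b; cases c)
    (simp add: six_ineqs_def generic_triangle_def generic_def trop_cross_def max_def)

text \<open>Sorting gives the last chain and decides the second entry of each cross product. Every
  order of the other two differences except the asserted one is inconsistent or makes two lines
  share a coordinate difference.\<close>

lemma sorted_generic_triangle_imp_six_ineqs:
  assumes "generic_triangle (a1, a2, a3) (b1, b2, b3) (c1, c2, c3)"
    and "a1 - a3 < b1 - b3" "b1 - b3 < c1 - c3"
  shows "six_ineqs (a1, a2, a3) (b1, b2, b3) (c1, c2, c3)"
  using assms
  unfolding six_ineqs_def generic_triangle_def generic_def trop_cross_def max_def
  by (simp; smt (verit))

lemma mset_triple_eq_iff:
  "mset [x, y, z] = mset [p, q, r] \<longleftrightarrow>
    (x, y, z) \<in> {(p, q, r), (p, r, q), (q, p, r), (q, r, p), (r, p, q), (r, q, p)}"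
  by (auto simp: add_eq_conv_ex)

lemma generic_triangle_iff:
  "generic_triangle p q r \<longleftrightarrow> (\<exists>a b c. mset [a, b, c] = mset [p, q, r] \<and> six_ineqs a b c)"
proof
  assume gen: "generic_triangle p q r"
  \<comment> \<open>The last chain of \<open>six_ineqs\<close> says that \<open>h\<close> increases
    along \<open>a\<close>, \<open>b\<close>, \<open>c\<close>, so sorting by \<open>h\<close>
    yields the only possible labeling.\<close>
  define h :: "vec3 \<Rightarrow> real" where "h = (\<lambda>(x1, x2, x3). x1 - x3)"
  have sorted: "six_ineqs a b c" if "generic_triangle a b c" "h a < h b" "h b < h c" for a b c
    using that sorted_generic_triangle_imp_six_ineqs by (cases a; cases b; cases c) (simp add: h_def)
  have "h p \<noteq> h q" "h q \<noteq> h r" "h r \<noteq> h p"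
    using gen by (auto simp: generic_triangle_def generic_def h_def split: prod.splits)
  then obtain a b c where abc: "mset [a, b, c] = mset [p, q, r]" "h a < h b" "h b < h c"
    unfolding mset_triple_eq_iff insert_iff prod.inject by (metis linorder_neq_iff)
  moreover have "generic_triangle a b c"
    using gen abc(1) unfolding mset_triple_eq_iff
    by (auto intro: generic_triangle_rotate generic_triangle_swap)
  ultimately show "\<exists>a b c. mset [a, b, c] = mset [p, q, r] \<and> six_ineqs a b c"
    using sorted by blast
next
  assume "\<exists>a b c. mset [a, b, c] = mset [p, q, r] \<and> six_ineqs a b c"
  then obtain a b c where "mset [a, b, c] = mset [p, q, r]" "generic_triangle a b c"
    using six_ineqs_imp_generic_triangle by blast
  then show "generic_triangle p q r"
    unfolding mset_triple_eq_iff
    by (auto intro: generic_triangle_rotate generic_triangle_swap)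
qed

theorem theorem2:
  fixes a b c :: tp2
    and a1' a2' a3' b1' b2' b3' c1' c2' c3' :: real
  assumes "a = tp_class (ereal a1') (ereal a2') (ereal a3')"
    and "b = tp_class (ereal b1') (ereal b2') (ereal b3')"
    and "c = tp_class (ereal c1') (ereal c2') (ereal c3')"
    and "distinct [a, b, c]"
  shows "transversal_triangle a b c \<longleftrightarrow>
    (\<exists>a1 a2 a3 b1 b2 b3 c1 c2 c3 :: real.
       mset [(a1, a2, a3), (b1, b2, b3), (c1, c2, c3)] =
         mset [(a1', a2', a3'), (b1', b2', b3'), (c1', c2', c3')] \<and>
       b1 - b2 < a1 - a2 \<and> a1 - a2 < c1 - c2 \<and>
       a2 - a3 < c2 - c3 \<and> c2 - c3 < b2 - b3 \<and>
       c3 - c1 < b3 - b1 \<and> b3 - b1 < a3 - a1)"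
proof -
  have "a = pt (a1', a2', a3')" "b = pt (b1', b2', b3')" "c = pt (c1', c2', c3')"
    using assms by (simp_all add: pt_def)
  then show ?thesis
    by (simp only: transversal_triangle_iff generic_triangle_iff split_paired_Ex
        six_ineqs_def prod.case)
qed

end
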